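(* Let $N\ge2$ and let $(\theta_t)_{t\ge0}$ be the ACCA dynamics on the ring, with first singular time $\tau$, wrapped increments $\delta_t(i)$, winding number $W_0$ of $\theta_0$, and $\beta=\frac{2\pi W_0}N$. Let $(s_t)$ be the compensator and set \[ \widetilde{\mathcal D}_t:=\frac1N\sum_{i=1}^N\Big(\delta_t(i)-\beta-\big(s_t(i+1)-s_t(i)\big)\Big)^2 . \] Then, on the event $\{\tau=\infty\}$, \[ \lim_{t\to\infty}\widetilde{\mathcal D}_t=0\qquad\text{almost surely} \] (i.e. the set of trajectories with $\tau=\infty$ for which this fails has probability zero).
   Context: For $a\in\mathbb R$, $\operatorname{wrap}_\pi(a):=a-2\pi\lfloor\frac{a+\pi}{2\pi}\rfloor\in[-\pi,\pi)$. The ring has vertices $1,\dots,N$ and edges $(i,i+1)$, $1\le i\le N$; vertex indices are read modulo $N$. For a configuration $\theta_t\in[-\pi,\pi)^N$: $\delta_t(i):=\operatorname{wrap}_\pi(\theta_t(i+1)-\theta_t(i))$, $1\le i\le N$; $W_t:=\frac1{2\pi}\sum_{i=1}^N\delta_t(i)\in\mathbb Z$; $S^{(t)}_\pm(k):=\delta_t(k\pm1)+\frac12\delta_t(k)$. ACCA dynamics: start from an initial configuration $\theta_0\in[-\pi,\pi)^N$; at each step $t$ an edge $(k,k+1)$ is chosen uniformly at random among the $N$ edges, independently of the past; then $\theta_{t+1}(k)=\operatorname{wrap}_\pi(\theta_t(k)+\frac12\delta_t(k))$, $\theta_{t+1}(k+1)=\operatorname{wrap}_\pi(\theta_t(k+1)-\frac12\delta_t(k))$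 (these coincide), and all other values are unchanged. (If $\delta_t(k)=-\pi$, the common new value is chosen with probability $1/2$ each between $\operatorname{wrap}_\pi(\theta_t(k)\pm\frac\pi2)$.) First singular time: $\tau:=\inf\{t\ge0:\ \exists k,\ S^{(t)}_-(k)\notin(-\pi,\pi)\text{ or }S^{(t)}_+(k)\notin(-\pi,\pi)\text{ or }\delta_t(k)=-\pi\}\in\mathbb N_0\cup\{\infty\}$. On $\{\tau=\infty\}$ one has $W_t=W_0$ for all $t$. Compensator: $s_0\equiv0\in\mathbb R^N$; when edge $(k,k+1)$ is updated at time $t$ (with $k+1$ read as $1$ if $k=N$), $s_{t+1}(k)=\frac{s_t(k)+s_t(k+1)}2+\frac\beta2$, $s_{t+1}(k+1)=\frac{s_t(k)+s_t(k+1)}2-\frac\beta2$, and $s_{t+1}(i)=s_t(i)$ otherwise; set $s_t(N+1):=s_t(1)$. *)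

theory Defs
  imports "HOL-Probability.Probability"
begin

text \<open>
  The ring has vertices \<open>1, \<dots>, N\<close>; edge \<open>k\<close> joins \<open>k\<close> and \<open>nxt N k\<close>.
  Functions on the ring have type \<open>nat \<Rightarrow> real\<close>; only their values on \<open>{1..N}\<close> are meaningful.
\<close>

definition nxt :: "nat \<Rightarrow> nat \<Rightarrow> nat" where
  "nxt N k = (if k = N then 1 else k + 1)"

definition prv :: "nat \<Rightarrow> nat \<Rightarrow> nat" where
  "prv N k = (if k = 1 then N else k - 1)"

definition wrap_pi :: "real \<Rightarrow> real" where
  "wrap_pi a = a - 2 * pi * real_of_int \<lfloor>(a + pi) / (2 * pi)\<rfloor>"

definition incr :: "nat \<Rightarrow> (nat \<Rightarrow> real) \<Rightarrow> nat \<Rightarrow> real" where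
  "incr N \<theta> i = wrap_pi (\<theta> (nxt N i) - \<theta> i)"

definition winding :: "nat \<Rightarrow> (nat \<Rightarrow> real) \<Rightarrow> real" where
  "winding N \<theta> = (1 / (2 * pi)) * (\<Sum>i=1..N. incr N \<theta> i)"

definition S_plus :: "nat \<Rightarrow> (nat \<Rightarrow> real) \<Rightarrow> nat \<Rightarrow> real" where
  "S_plus N \<theta> k = incr N \<theta> (nxt N k) + (1/2) * incr N \<theta> k"

definition S_minus :: "nat \<Rightarrow> (nat \<Rightarrow> real) \<Rightarrow> nat \<Rightarrow> real" where
  "S_minus N \<theta> k = incr N \<theta> (prv N k) + (1/2) * incr N \<theta> k"

definition singular :: "nat \<Rightarrow> (nat \<Rightarrow> real) \<Rightarrow> bool" where
  "singular N \<theta> \<longleftrightarrow>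
     (\<exists>k\<in>{1..N}. S_minus N \<theta> k \<notin> {-pi<..<pi} \<or> S_plus N \<theta> k \<notin> {-pi<..<pi} \<or> incr N \<theta> k = -pi)"

text \<open>The coin \<open>c\<close> is consulted only in the antipodal case.\<close>

definition acca_step :: "nat \<Rightarrow> nat \<Rightarrow> bool \<Rightarrow> (nat \<Rightarrow> real) \<Rightarrow> nat \<Rightarrow> real" where
  "acca_step N k c \<theta> =
     (if incr N \<theta> k = -pi
      then (let v = wrap_pi (if c then \<theta> k + pi / 2 else \<theta> k - pi / 2)
            in \<theta>(k := v, nxt N k := v))
      else \<theta>(k := wrap_pi (\<theta> k + (1/2) * incr N \<theta> k),
             nxt N k := wrap_pi (\<theta> (nxt N k) - (1/2) * incr N \<theta> k)))"

text \<open>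
  \<open>K t\<close> is the edge chosen at step \<open>t\<close> and \<open>C t\<close> a fair coin, tossed at every step whether or not
  it is needed. \<open>F t\<close> is the information available before step \<open>t\<close>. The initial configuration may
  be random; a deterministic one is the case of constant \<open>\<theta> 0\<close>.
\<close>

locale acca = prob_space M + filtration "space M" F
  for M :: "'w measure" and F :: "nat \<Rightarrow> 'w measure" +
  fixes N :: nat
    and K :: "nat \<Rightarrow> 'w \<Rightarrow> nat"
    and C :: "nat \<Rightarrow> 'w \<Rightarrow> bool"
    and \<theta> :: "nat \<Rightarrow> 'w \<Rightarrow> nat \<Rightarrow> real"
  assumes subalgebra_F: "\<And>t. subalgebra M (F t)"
    and init_measurable: "\<And>i. i \<in> {1..N} \<Longrightarrow> (\<lambda>\<omega>. \<theta> 0 \<omega> i) \<in> borel_measurable (F 0)"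
    and init_range: "\<And>\<omega> i. \<omega> \<in> space M \<Longrightarrow> i \<in> {1..N} \<Longrightarrow> \<theta> 0 \<omega> i \<in> {-pi..<pi}"
    and choice_adapted:
      "\<And>t. (\<lambda>\<omega>. (K t \<omega>, C t \<omega>)) \<in> F (Suc t) \<rightarrow>\<^sub>M count_space ({1..N} \<times> UNIV)"
    and choice_uniform:
      "\<And>t. distr M (count_space ({1..N} \<times> UNIV)) (\<lambda>\<omega>. (K t \<omega>, C t \<omega>))
             = uniform_count_measure ({1..N} \<times> UNIV)"
    and choice_indep_past:
      "\<And>t. indep_set (sets (F t))
             (sets (vimage_algebra (space M) (\<lambda>\<omega>. (K t \<omega>, C t \<omega>)) (count_space ({1..N} \<times> UNIV))))"
    and evolution:
      "\<And>t \<omega> i. \<omega> \<in> space M \<Longrightarrow> i \<in> {1..N} \<Longrightarrow>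
         \<theta> (Suc t) \<omega> i = acca_step N (K t \<omega>) (C t \<omega>) (\<theta> t \<omega>) i"

definition first_singular_time :: "nat \<Rightarrow> (nat \<Rightarrow> nat \<Rightarrow> real) \<Rightarrow> enat" where
  "first_singular_time N \<theta> = Inf (enat ` {t. singular N (\<theta> t)})"

primrec compensator :: "nat \<Rightarrow> real \<Rightarrow> (nat \<Rightarrow> nat) \<Rightarrow> nat \<Rightarrow> nat \<Rightarrow> real" where
  "compensator N \<beta> \<kappa> 0 = (\<lambda>_. 0)"
| "compensator N \<beta> \<kappa> (Suc t) =
     (let s = compensator N \<beta> \<kappa> t; k = \<kappa> t; m = (s k + s (nxt N k)) / 2
      in s(k := m + \<beta> / 2, nxt N k := m - \<beta> / 2))"

definition compensated_energy :: "nat \<Rightarrow> real \<Rightarrow> (nat \<Rightarrow> real) \<Rightarrow> (nat \<Rightarrow> real) \<Rightarrow> real" where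
  "compensated_energy N \<beta> \<theta> s =
     (1 / real N) * (\<Sum>i=1..N. (incr N \<theta> i - \<beta> - (s (nxt N i) - s i))\<^sup>2)"

end

theory Submission
  imports Defs
begin

text \<open>
  Off the singular set an update acts linearly on the increments, so as long as none occurs one can
  write \<open>\<delta>\<^sub>t(i) - \<beta> - (s\<^sub>t(i+1) - s\<^sub>t(i)) = u\<^sub>t(i+1) - u\<^sub>t(i)\<close>, where \<open>u\<close> is a real function on the
  vertices that evolves by replacing both end values of the chosen edge by their mean: the
  compensator absorbs exactly the defect caused by the winding. Averaging never enlarges the range
  of \<open>u\<close>, and updating the edges \<open>1, \<dots>, N - 1\<close> in this order shrinks it by the factor
  \<open>1 - 2\<^bsup>-(N-1)\<^esup>\<close>, because the initial value at vertex 1 then enters every value with weight at least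
  \<open>2\<^bsup>-(N-1)\<^esup>\<close>. Almost surely the edges are chosen in this order infinitely often.
\<close>

section \<open>Wrapping\<close>

text \<open>The half-open interval contains exactly one representative of each class modulo
  \<open>2 * pi\<close>. Every later computation of a wrapped value reduces to exhibiting the
  integer \<open>n\<close>.\<close>

lemma wrap_pi_eqI:
  assumes "x \<in> {-pi..<pi}" and "a = x + 2 * pi * of_int n"
  shows "wrap_pi a = x"
proof -
  have "(a + pi) / (2 * pi) = of_int n + (x + pi) / (2 * pi)"
    using assms(2) by (simp add: field_simps)
  moreover have "\<lfloor>(x + pi) / (2 * pi)\<rfloor> = 0"
    using assms(1) by (auto simp: floor_eq_iff field_simps)
  ultimately have "\<lfloor>(a + pi) / (2 * pi)\<rfloor> = n"
    by simp
  then show ?thesis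
    using assms(2) by (simp add: wrap_pi_def)
qed

lemma wrap_pi_obtain:
  obtains n :: int where "wrap_pi a = a + 2 * pi * of_int n"
  by (rule that[of "- \<lfloor>(a + pi) / (2 * pi)\<rfloor>"]) (simp add: wrap_pi_def)

lemma wrap_pi_range: "wrap_pi a \<in> {-pi..<pi}"
proof -
  let ?y = "(a + pi) / (2 * pi)"
  have "wrap_pi a = 2 * pi * (?y - of_int \<lfloor>?y\<rfloor>) - pi"
    by (simp add: wrap_pi_def field_simps)
  moreover have "0 \<le> ?y - of_int \<lfloor>?y\<rfloor>" "?y - of_int \<lfloor>?y\<rfloor> < 1"
    by linarith+
  then have "0 \<le> 2 * pi * (?y - of_int \<lfloor>?y\<rfloor>)" "2 * pi * (?y - of_int \<lfloor>?y\<rfloor>) < 2 * pi"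
    using mult_strict_left_mono[of "?y - of_int \<lfloor>?y\<rfloor>" 1 "2 * pi"] by simp_all
  ultimately show ?thesis
    by simp
qed

text \<open>Negation maps the open interval to itself; only the left end point \<open>-pi\<close>
  would be sent out of the half-open one.\<close>

lemma wrap_pi_minus:
  assumes "wrap_pi a \<noteq> -pi"
  shows "wrap_pi (- a) = - wrap_pi a"
proof -
  obtain n where "wrap_pi a = a + 2 * pi * of_int n"
    by (rule wrap_pi_obtain)
  then show ?thesis
    using assms wrap_pi_range[of a] by (intro wrap_pi_eqI[where n = n]) auto
qed

section \<open>Regular updates of the increments\<close>

lemma nxt_in: "k \<in> {1..N} \<Longrightarrow> nxt N k \<in> {1..N}"
  by (auto simp: nxt_def)

lemma nxt_neq: "2 \<le> N \<Longrightarrow> k \<in> {1..N} \<Longrightarrow> nxt N k \<noteq> k"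
  by (auto simp: nxt_def)

lemma nxt_prv: "k \<in> {1..N} \<Longrightarrow> nxt N (prv N k) = k"
  by (auto simp: nxt_def prv_def)

lemma nxt_eq_iff: "k \<in> {1..N} \<Longrightarrow> i \<in> {1..N} \<Longrightarrow> nxt N i = k \<longleftrightarrow> i = prv N k"
  by (auto simp: nxt_def prv_def)

lemma nxt_neq_prv: "3 \<le> N \<Longrightarrow> k \<in> {1..N} \<Longrightarrow> nxt N k \<noteq> prv N k"
  by (auto simp: nxt_def prv_def)

lemma prv_neq: "2 \<le> N \<Longrightarrow> k \<in> {1..N} \<Longrightarrow> prv N k \<noteq> k"
  by (auto simp: prv_def)

lemma nxt_inj: "k \<in> {1..N} \<Longrightarrow> i \<in> {1..N} \<Longrightarrow> nxt N i = nxt N k \<longleftrightarrow> i = k"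
  by (auto simp: nxt_def)

text \<open>The two midpoints differ by
  \<open>\<theta> (nxt N k) - \<theta> k - incr N \<theta> k\<close>, a multiple of
  \<open>2 * pi\<close>, which wrapping removes; in the antipodal case both ends receive the same
  \<open>v\<close>.\<close>

lemma acca_step_endpoints:
  assumes "2 \<le> N" "k \<in> {1..N}"
  shows "acca_step N k c \<theta> (nxt N k) = acca_step N k c \<theta> k"
proof (cases "incr N \<theta> k = -pi")
  case True
  then show ?thesis
    by (simp add: acca_step_def Let_def)
next
  case False
  let ?d = "incr N \<theta> k"
  obtain n where n: "?d = \<theta> (nxt N k) - \<theta> k + 2 * pi * of_int n"
    unfolding incr_def by (rule wrap_pi_obtain)
  obtain m where m: "wrap_pi (\<theta> k + ?d / 2) = \<theta> k + ?d / 2 + 2 * pi * of_int m"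
    by (rule wrap_pi_obtain)
  have "\<theta> (nxt N k) - ?d / 2 = wrap_pi (\<theta> k + ?d / 2) + 2 * pi * of_int (- m - n)"
    using n m by (simp add: algebra_simps)
  then have "wrap_pi (\<theta> (nxt N k) - ?d / 2) = wrap_pi (\<theta> k + ?d / 2)"
    by (rule wrap_pi_eqI[OF wrap_pi_range])
  then show ?thesis
    using False nxt_neq[OF assms] by (simp add: acca_step_def)
qed

lemma incr_acca_step_self:
  assumes "2 \<le> N" "k \<in> {1..N}"
  shows "incr N (acca_step N k c \<theta>) k = 0"
  unfolding incr_def acca_step_endpoints[OF assms]
  by (rule wrap_pi_eqI[where n = 0]) auto

lemma not_singularD:
  assumes "\<not> singular N \<theta>" "k \<in> {1..N}"
  shows "S_plus N \<theta> k \<in> {-pi<..<pi}" "S_minus N \<theta> k \<in> {-pi<..<pi}" "incr N \<theta> k \<noteq> -pi"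
  using assms by (auto simp: singular_def)

text \<open>Modulo \<open>2 * pi\<close> the new increment gains half of the increment at
  \<open>k\<close>, and regularity keeps this sum inside the interval, so no wrap occurs. With
  \<open>3 \<le> N\<close> the far end of the edge \<open>nxt N k\<close> is not \<open>k\<close>
  and keeps its value.\<close>

lemma incr_acca_step_nxt:
  assumes "3 \<le> N" "k \<in> {1..N}" "\<not> singular N \<theta>"
  shows "incr N (acca_step N k c \<theta>) (nxt N k) = S_plus N \<theta> k"
proof -
  let ?d = "incr N \<theta> k" and ?j = "nxt N k"
  have neq: "nxt N ?j \<noteq> k" "nxt N ?j \<noteq> ?j"
    using assms(1,2) by (auto simp: nxt_def)
  note ns = not_singularD[OF assms(3,2)]
  have "incr N (acca_step N k c \<theta>) ?j = wrap_pi (\<theta> (nxt N ?j) - wrap_pi (\<theta> ?j - ?d / 2))"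
    using neq ns(3) by (simp add: incr_def[of N _ ?j] acca_step_def)
  moreover obtain n where n: "wrap_pi (\<theta> ?j - ?d / 2) = \<theta> ?j - ?d / 2 + 2 * pi * of_int n"
    by (rule wrap_pi_obtain)
  moreover obtain m where m: "incr N \<theta> ?j = \<theta> (nxt N ?j) - \<theta> ?j + 2 * pi * of_int m"
    unfolding incr_def by (rule wrap_pi_obtain)
  have "wrap_pi (\<theta> (nxt N ?j) - wrap_pi (\<theta> ?j - ?d / 2)) = S_plus N \<theta> k"
    using n m ns by (intro wrap_pi_eqI[where n = "- n - m"]) (auto simp: S_plus_def algebra_simps)
  ultimately show ?thesis
    by simp
qed

lemma incr_acca_step_prv:
  assumes "3 \<le> N" "k \<in> {1..N}" "\<not> singular N \<theta>"
  shows "incr N (acca_step N k c \<theta>) (prv N k) = S_minus N \<theta> k"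
proof -
  let ?d = "incr N \<theta> k" and ?j = "prv N k"
  have neq: "?j \<noteq> k" "?j \<noteq> nxt N k" "nxt N k \<noteq> k" and nj: "nxt N ?j = k"
    using assms(1,2) nxt_neq_prv[OF assms(1,2)] prv_neq nxt_neq nxt_prv by auto
  note ns = not_singularD[OF assms(3,2)]
  have "incr N (acca_step N k c \<theta>) ?j = wrap_pi (wrap_pi (\<theta> k + ?d / 2) - \<theta> ?j)"
    using neq ns(3) by (simp add: incr_def[of N _ ?j] acca_step_def nj)
  moreover obtain n where n: "wrap_pi (\<theta> k + ?d / 2) = \<theta> k + ?d / 2 + 2 * pi * of_int n"
    by (rule wrap_pi_obtain)
  moreover obtain m where m: "incr N \<theta> ?j = \<theta> k - \<theta> ?j + 2 * pi * of_int m"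
    unfolding incr_def nj by (rule wrap_pi_obtain)
  have "wrap_pi (wrap_pi (\<theta> k + ?d / 2) - \<theta> ?j) = S_minus N \<theta> k"
    using n m ns by (intro wrap_pi_eqI[where n = "n - m"]) (auto simp: S_minus_def algebra_simps)
  ultimately show ?thesis
    by simp
qed

lemma incr_acca_step_other:
  assumes "i \<in> {1..N}" "k \<in> {1..N}" "i \<noteq> k" "i \<noteq> nxt N k" "i \<noteq> prv N k"
  shows "incr N (acca_step N k c \<theta>) i = incr N \<theta> i"
proof -
  have "nxt N i \<noteq> k" "nxt N i \<noteq> nxt N k"
    using assms nxt_eq_iff nxt_inj by auto
  then show ?thesis
    using assms by (simp add: incr_def acca_step_def Let_def)
qed

lemma incr_cong:
  assumes "\<And>i. i \<in> {1..N} \<Longrightarrow> \<theta> i = \<theta>' i" and "i \<in> {1..N}"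
  shows "incr N \<theta> i = incr N \<theta>' i"
  using assms nxt_in[OF assms(2)] by (simp add: incr_def)

section \<open>Averaging\<close>

definition avg_step :: "nat \<Rightarrow> nat \<Rightarrow> (nat \<Rightarrow> real) \<Rightarrow> nat \<Rightarrow> real" where
  "avg_step N k u = (let m = (u k + u (nxt N k)) / 2 in u(k := m, nxt N k := m))"

primrec averaging :: "nat \<Rightarrow> (nat \<Rightarrow> nat) \<Rightarrow> (nat \<Rightarrow> real) \<Rightarrow> nat \<Rightarrow> nat \<Rightarrow> real" where
  "averaging N \<kappa> u 0 = u"
| "averaging N \<kappa> u (Suc t) = avg_step N (\<kappa> t) (averaging N \<kappa> u t)"

text \<open>For \<open>N = 2\<close> the two edges join the same vertices, so the linear formulas for the neighbouring
  increments fail; regularity forces \<open>\<beta> = 0\<close> there, and one update makes all increments vanish.\<close>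

lemma lift_step:
  fixes u :: "nat \<Rightarrow> real" and \<beta> :: real and N :: nat
  defines "p \<equiv> \<lambda>\<kappa> t i. compensator N \<beta> \<kappa> t i + averaging N \<kappa> u t i"
  assumes N: "2 \<le> N" and k: "\<kappa> t \<in> {1..N}" and ns: "\<not> singular N \<theta>"
    and \<delta>: "\<And>i. i \<in> {1..N} \<Longrightarrow> incr N \<theta> i = \<beta> + p \<kappa> t (nxt N i) - p \<kappa> t i"
    and i: "i \<in> {1..N}"
  shows "incr N (acca_step N (\<kappa> t) c \<theta>) i = \<beta> + p \<kappa> (Suc t) (nxt N i) - p \<kappa> (Suc t) i"
proof -
  let ?k = "\<kappa> t"
  \<comment> \<open>The compensator leaves the new end values \<open>\<beta>\<close> apart, which
    cancels the \<open>\<beta>\<close> in the formula for the vanishing increment. Each end value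
    also moves by half the old increment, as the neighbouring increments require.\<close>
  have p_k: "p \<kappa> (Suc t) ?k = (p \<kappa> t ?k + p \<kappa> t (nxt N ?k)) / 2 + \<beta> / 2"
    and p_nxt: "p \<kappa> (Suc t) (nxt N ?k) = (p \<kappa> t ?k + p \<kappa> t (nxt N ?k)) / 2 - \<beta> / 2"
    using nxt_neq[OF N k] by (auto simp: p_def Let_def avg_step_def field_simps)
  have p_other: "p \<kappa> (Suc t) j = p \<kappa> t j" if "j \<noteq> ?k" "j \<noteq> nxt N ?k" for j
    using that by (simp add: p_def Let_def avg_step_def)
  have \<delta>k: "incr N \<theta> ?k = \<beta> + p \<kappa> t (nxt N ?k) - p \<kappa> t ?k"
    using \<delta>[OF k] .
  consider "i = ?k" | "N = 2" "i \<noteq> ?k" | "3 \<le> N" "i \<noteq> ?k"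
    using N by linarith
  then show ?thesis
  proof cases
    case 1
    then show ?thesis
      using incr_acca_step_self[OF N k] p_k p_nxt by simp
  next
    case 2
    have nk: "nxt N ?k = i" "nxt N i = ?k"
      using 2 i k by (auto simp: nxt_def)
    have "incr N \<theta> i = wrap_pi (- (\<theta> i - \<theta> ?k))"
      by (simp add: incr_def nk)
    also have "\<dots> = - incr N \<theta> ?k"
      using not_singularD(3)[OF ns k] by (subst wrap_pi_minus) (auto simp: incr_def nk)
    \<comment> \<open>Adding the formulas for the two opposite increments cancels \<open>p\<close>
      and leaves \<open>2 * \<beta> = 0\<close>.\<close>
    finally have "\<beta> = 0"
      using \<delta>[OF i] \<delta>k by (simp add: nk)
    moreover have "incr N (acca_step N ?k c \<theta>) i = 0"
      using acca_step_endpoints[OF N k, of c \<theta>]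
      by (simp add: incr_def nk wrap_pi_eqI[where n = 0])
    ultimately show ?thesis
      using p_k p_nxt by (simp add: nk)
  next
    case 3
    consider "i = nxt N ?k" | "i = prv N ?k" "i \<noteq> nxt N ?k" | "i \<noteq> nxt N ?k" "i \<noteq> prv N ?k"
      by blast
    then show ?thesis
    proof cases
      case 1
      have "nxt N (nxt N ?k) \<noteq> ?k" "nxt N (nxt N ?k) \<noteq> nxt N ?k"
        using 3 k by (auto simp: nxt_def)
      then show ?thesis
        using 1 incr_acca_step_nxt[OF 3(1) k ns, of c] \<delta>k \<delta>[OF i] p_nxt
          p_other[of "nxt N (nxt N ?k)"]
        by (simp add: S_plus_def field_simps)
    next
      case 2
      then show ?thesis
        using incr_acca_step_prv[OF 3(1) k ns, of c] \<delta>k \<delta>[OF i] p_k p_other[of i] 3 nxt_prv[OF k]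
        by (simp add: S_minus_def field_simps)
    next
      case other: 3
      have "nxt N i \<noteq> ?k" "nxt N i \<noteq> nxt N ?k"
        using 3 other i k nxt_eq_iff nxt_inj by auto
      then show ?thesis
        using incr_acca_step_other[OF i k 3(2) other] \<delta>[OF i] p_other 3 other by simp
    qed
  qed
qed

text \<open>Partial sums form a potential for \<open>d\<close>. The zero total enters at the closing
  edge \<open>i = N\<close>, where \<open>nxt\<close> returns to 1 and the first sum is
  empty.\<close>

lemma lift_init:
  assumes "1 \<le> N" and "(\<Sum>i=1..N. d i) = (0::real)" and "i \<in> {1..N}"
  shows "(\<Sum>j=1..<nxt N i. d j) - (\<Sum>j=1..<i. d j) = d i"
proof (cases "i = N")
  case True
  have "{1..N} = insert N {1..<N}"
    using assms(1) by auto
  then have "(\<Sum>j=1..<N. d j) + d N = 0"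
    using assms(2) by simp
  then show ?thesis
    using True by (simp add: nxt_def)
next
  case False
  then show ?thesis
    using assms(3) by (simp add: nxt_def)
qed

section \<open>Contraction of the range by sweeps\<close>

text \<open>For \<open>w\<close> in the unit interval, the first interval consists of the convex
  combinations giving weight \<open>w\<close> to \<open>z\<close> and the rest to a point of
  \<open>{a..b}\<close>. Averaging with an arbitrary point of \<open>{a..b}\<close> halves that
  weight.\<close>

lemma average_weight:
  fixes x y z a b w :: real
  assumes "x \<in> {a + w * (z - a)..b - w * (b - z)}" and "y \<in> {a..b}"
  shows "(x + y) / 2 \<in> {a + w / 2 * (z - a)..b - w / 2 * (b - z)}"
  using assms by (auto simp: field_simps)

lemma avg_step_range:
  assumes "k \<in> {1..N}" and "u ` {1..N} \<subseteq> {a..b}"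
  shows "avg_step N k u ` {1..N} \<subseteq> {a..b}"
proof -
  have "u k \<in> {a..b}" "u (nxt N k) \<in> {a..b}"
    using assms nxt_in[OF assms(1)] by blast+
  then have "(u k + u (nxt N k)) / 2 \<in> {a..b}"
    by auto
  then show ?thesis
    using assms(2) by (auto simp: avg_step_def Let_def)
qed

lemma averaging_range:
  assumes "\<And>t. \<kappa> t \<in> {1..N}" and "averaging N \<kappa> u t ` {1..N} \<subseteq> {a..b}" and "t \<le> t'"
  shows "averaging N \<kappa> u t' ` {1..N} \<subseteq> {a..b}"
  using assms(3,2)
proof (induction t' rule: dec_induct)
  case (step n)
  then have "averaging N \<kappa> u n ` {1..N} \<subseteq> {a..b}"
    by blast
  then show ?case
    using avg_step_range[OF assms(1)] by simp
qed

definition sweep :: "nat \<Rightarrow> (nat \<Rightarrow> nat) \<Rightarrow> nat \<Rightarrow> bool" where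
  "sweep n \<kappa> t \<longleftrightarrow> (\<forall>j<n. \<kappa> (t + j) = Suc j)"

lemma sweep_Suc: "sweep (Suc n) \<kappa> t \<longleftrightarrow> sweep n \<kappa> t \<and> \<kappa> (t + n) = Suc n"
  by (auto simp: sweep_def less_Suc_eq)

text \<open>The influence of \<open>z\<close> travels along the path: the update of edge
  \<open>Suc n\<close> passes it from vertex \<open>Suc n\<close> to the next vertex at half the
  weight.\<close>

lemma averaging_sweep:
  assumes "sweep n \<kappa> t" and "n < N" and "averaging N \<kappa> u t ` {1..N} \<subseteq> {a..b}"
  defines "z \<equiv> averaging N \<kappa> u t 1"
  shows "averaging N \<kappa> u (t + n) ` {1..Suc n} \<subseteq> {a + (1/2)^n * (z - a)..b - (1/2)^n * (b - z)}"
proof -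
  \<comment> \<open>The bound on all vertices is carried along because the next update involves a
    vertex that the sweep has not yet reached.\<close>
  have "averaging N \<kappa> u (t + n) ` {1..N} \<subseteq> {a..b} \<and>
        averaging N \<kappa> u (t + n) ` {1..Suc n} \<subseteq> {a + (1/2)^n * (z - a)..b - (1/2)^n * (b - z)}"
    using assms(1,2)
  proof (induction n)
    case 0
    then show ?case
      using assms(3) by (simp add: z_def)
  next
    case (Suc n)
    let ?v = "averaging N \<kappa> u (t + n)"
      and ?I = "\<lambda>n. {a + (1/2)^n * (z - a)..b - (1/2)^n * (b - z)}"
    have all: "?v ` {1..N} \<subseteq> {a..b}" and init: "?v ` {1..Suc n} \<subseteq> ?I n" and k: "\<kappa> (t + n) = Suc n"
      using Suc by (auto simp: sweep_Suc)
    have nx: "nxt N (Suc n) = Suc (Suc n)"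
      using Suc.prems by (simp add: nxt_def)
    have z: "z \<in> {a..b}"
      using assms(2,3) by (auto simp: z_def image_subset_iff)
    have "?v (Suc n) \<in> ?I n" "?v (Suc (Suc n)) \<in> {a..b}"
      using init all Suc.prems by (auto simp: image_subset_iff)
    then have mid: "(?v (Suc n) + ?v (Suc (Suc n))) / 2 \<in> ?I (Suc n)"
      using average_weight[of "?v (Suc n)" a "(1/2)^n" z b] by simp
    \<comment> \<open>Demanding less weight on \<open>z\<close> widens the interval, so vertices
      left unchanged by the update also satisfy the weaker bound.\<close>
    have "(1/2)^Suc n * y \<le> (1/2)^n * y" if "0 \<le> y" for y :: real
      using that by simp
    from this[of "z - a"] this[of "b - z"] z have sub: "?I n \<subseteq> ?I (Suc n)"
      by (auto simp del: power_Suc)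
    have "avg_step N (Suc n) ?v i \<in> ?I (Suc n)" if "i \<in> {1..Suc (Suc n)}" for i
    proof (cases "i \<in> {Suc n, Suc (Suc n)}")
      case True
      then show ?thesis
        using mid by (auto simp: avg_step_def Let_def nx)
    next
      case False
      then have "?v i \<in> ?I n"
        using init that by (auto simp: image_subset_iff)
      then have "?v i \<in> ?I (Suc n)"
        using sub by blast
      moreover have "avg_step N (Suc n) ?v i = ?v i"
        using False by (simp add: avg_step_def Let_def nx)
      ultimately show ?thesis
        by (simp only:)
    qed
    moreover have "avg_step N (Suc n) ?v ` {1..N} \<subseteq> {a..b}"
      using all Suc.prems by (intro avg_step_range) auto
    ultimately show ?case
      using k by auto
  qed
  then show ?thesis
    by blast
qed

text \<open>Waiting for the next sweep costs nothing, since averaging preserves any enclosing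
  interval; the sweep itself then shortens the interval by a fixed factor. The constant
  \<open>d\<close> is the initial range.\<close>

lemma averaging_contract:
  assumes N: "1 \<le> N" and \<kappa>: "\<And>t. \<kappa> t \<in> {1..N}" and sw: "\<And>T. \<exists>t\<ge>T. sweep (N - 1) \<kappa> t"
  shows "\<exists>d. \<forall>n. \<exists>T a b. b - a = (1 - (1/2)^(N - 1))^n * d \<and>
           averaging N \<kappa> u T ` {1..N} \<subseteq> {a..b}"
proof -
  let ?c = "1 - (1/2)^(N - 1) :: real"
  define a0 where "a0 = Min (u ` {1..N})"
  define b0 where "b0 = Max (u ` {1..N})"
  have u0: "u ` {1..N} \<subseteq> {a0..b0}"
    by (auto simp: a0_def b0_def)
  have "\<exists>T a b. b - a = ?c^n * (b0 - a0) \<and> averaging N \<kappa> u T ` {1..N} \<subseteq> {a..b}" for n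
  proof (induction n)
    case 0
    then show ?case
      using u0 by (intro exI[of _ 0] exI[of _ a0] exI[of _ b0]) simp
  next
    case (Suc n)
    then obtain T a b where ab: "b - a = ?c^n * (b0 - a0)"
      and T: "averaging N \<kappa> u T ` {1..N} \<subseteq> {a..b}"
      by blast
    obtain t where "T \<le> t" and t: "sweep (N - 1) \<kappa> t"
      using sw by blast
    then have "averaging N \<kappa> u t ` {1..N} \<subseteq> {a..b}"
      using averaging_range[OF \<kappa> T] by blast
    define z where "z = averaging N \<kappa> u t 1"
    let ?w = "(1/2)^(N - 1) :: real"
    have "averaging N \<kappa> u (t + (N - 1)) ` {1..N} \<subseteq> {a + ?w * (z - a)..b - ?w * (b - z)}"
      using averaging_sweep[OF t _ \<open>averaging N \<kappa> u t ` {1..N} \<subseteq> {a..b}\<close>] N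
      by (simp add: z_def)
    \<comment> \<open>The two ends move inward by amounts depending on \<open>z\<close>, but their
      sum \<open>?w * (b - a)\<close> does not.\<close>
    moreover have "b - ?w * (b - z) - (a + ?w * (z - a)) = ?c * (b - a)"
      by (simp add: algebra_simps)
    ultimately show ?case
      using ab by (metis mult.assoc power_Suc)
  qed
  then show ?thesis
    by blast
qed

text \<open>A short enclosing interval found at one time \<open>T\<close> still encloses all values
  at every later time.\<close>

lemma averaging_diff_tendsto_0:
  assumes N: "1 \<le> N" and \<kappa>: "\<And>t. \<kappa> t \<in> {1..N}" and sw: "\<And>T. \<exists>t\<ge>T. sweep (N - 1) \<kappa> t"
    and ij: "i \<in> {1..N}" "j \<in> {1..N}"
  shows "(\<lambda>t. averaging N \<kappa> u t i - averaging N \<kappa> u t j) \<longlonglongrightarrow> 0"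
proof (rule LIMSEQ_I)
  fix e :: real assume e: "e > 0"
  let ?c = "1 - (1/2)^(N - 1) :: real"
  obtain d where d: "\<And>n. \<exists>T a b. b - a = ?c^n * d \<and> averaging N \<kappa> u T ` {1..N} \<subseteq> {a..b}"
    using averaging_contract[OF N \<kappa> sw] by meson
  have "?c \<ge> 0" "?c < 1"
    by (auto simp: power_le_one)
  then have "(\<lambda>n. ?c^n * d) \<longlonglongrightarrow> 0"
    by (intro tendsto_mult_left_zero LIMSEQ_power_zero) auto
  then obtain n where n: "?c^n * d < e"
    using e by (metis eventually_sequentially order_refl order_tendstoD(2))
  obtain T a b where ab: "b - a = ?c^n * d" and T: "averaging N \<kappa> u T ` {1..N} \<subseteq> {a..b}"
    using d by blast
  have "norm (averaging N \<kappa> u t i - averaging N \<kappa> u t j - 0) < e" if "t \<ge> T" for t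
  proof -
    have "averaging N \<kappa> u t ` {1..N} \<subseteq> {a..b}"
      using averaging_range[OF \<kappa> T that] .
    then have "averaging N \<kappa> u t i \<in> {a..b}" "averaging N \<kappa> u t j \<in> {a..b}"
      using ij by blast+
    then show ?thesis
      using n unfolding ab[symmetric] by auto
  qed
  then show "\<exists>T. \<forall>t\<ge>T. norm (averaging N \<kappa> u t i - averaging N \<kappa> u t j - 0) < e"
    by blast
qed

section \<open>Sweeps occur infinitely often\<close>

context acca
begin

lemma space_F: "space (F t) = space M"
  using subalgebra_F by (simp add: subalgebra_def)

lemma K_in: "\<omega> \<in> space M \<Longrightarrow> K t \<omega> \<in> {1..N}"
  using measurable_space[OF choice_adapted, of \<omega> t] space_F by auto

lemma F_mono: "s \<le> t \<Longrightarrow> A \<in> sets (F s) \<Longrightarrow> A \<in> sets (F t)"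
  using sets_F_mono by blast

lemma F_events: "A \<in> sets (F t) \<Longrightarrow> A \<in> events"
  using subalgebra_F[of t] by (auto simp: subalgebra_def)

lemma choice_event: "{\<omega> \<in> space M. K t \<omega> = k} \<in> sets (F (Suc t))"
proof -
  have "(\<lambda>\<omega>. (K t \<omega>, C t \<omega>)) -` ({k} \<times> UNIV \<inter> {1..N} \<times> UNIV) \<inter> space (F (Suc t)) \<in> sets (F (Suc t))"
    by (rule measurable_sets[OF choice_adapted]) auto
  also have "(\<lambda>\<omega>. (K t \<omega>, C t \<omega>)) -` ({k} \<times> UNIV \<inter> {1..N} \<times> UNIV) \<inter> space (F (Suc t))
      = {\<omega> \<in> space M. K t \<omega> = k}"
    using K_in space_F by auto
  finally show ?thesis .
qed

lemma prob_past_choice: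
  assumes A: "A \<in> sets (F t)" and k: "k \<in> {1..N}"
  shows "prob (A \<inter> {\<omega> \<in> space M. K t \<omega> = k}) = prob A / N"
proof -
  let ?X = "\<lambda>\<omega>. (K t \<omega>, C t \<omega>)" and ?S = "{1..N} \<times> (UNIV :: bool set)"
  let ?B = "{\<omega> \<in> space M. K t \<omega> = k}"
  have B: "?B = ?X -` ({k} \<times> UNIV) \<inter> space M"
    by auto
  have X: "?X \<in> M \<rightarrow>\<^sub>M count_space ?S"
    using choice_adapted[of t] subalgebra_F[of "Suc t"]
    by (rule measurable_from_subalg[rotated])
  have "?B \<in> sets (vimage_algebra (space M) ?X (count_space ?S))"
    unfolding B using k by (intro in_vimage_algebra) auto
  then have "prob (A \<inter> ?B) = prob A * prob ?B"
    using choice_indep_past[of t] A by (auto dest: indep_setD)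
  moreover have "prob ?B = measure (distr M (count_space ?S) ?X) ({k} \<times> UNIV)"
    unfolding B using k by (subst measure_distr[OF X]) auto
  moreover have "\<dots> = 1 / N"
    unfolding choice_uniform using k
    by (subst measure_uniform_count_measure) (auto simp: card_cartesian_product)
  ultimately show ?thesis
    by simp
qed

text \<open>Each prescribed edge contributes an independent factor \<open>1 / N\<close>.
  Measurability is part of the induction because the partial sweep must belong to the past of the
  next choice.\<close>

lemma prob_past_sweep:
  assumes A: "A \<in> sets (F t)" and n: "n \<le> N"
  shows "A \<inter> {\<omega> \<in> space M. sweep n (\<lambda>u. K u \<omega>) t} \<in> sets (F (t + n)) \<and>
         prob (A \<inter> {\<omega> \<in> space M. sweep n (\<lambda>u. K u \<omega>) t}) = prob A * (1 / N)^n"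
  using n
proof (induction n)
  case 0
  have "A \<subseteq> space M"
    using sets.sets_into_space[OF A] space_F by simp
  then have "A \<inter> space M = A"
    by blast
  then show ?case
    using A by (simp add: sweep_def)
next
  case (Suc n)
  let ?A = "A \<inter> {\<omega> \<in> space M. sweep n (\<lambda>u. K u \<omega>) t}"
  let ?B = "{\<omega> \<in> space M. K (t + n) \<omega> = Suc n}"
  have eq: "A \<inter> {\<omega> \<in> space M. sweep (Suc n) (\<lambda>u. K u \<omega>) t} = ?A \<inter> ?B"
    by (auto simp: sweep_Suc)
  have m: "?A \<in> sets (F (t + n))" and p: "prob ?A = prob A * (1 / N)^n"
    using Suc by auto
  have "?A \<in> sets (F (Suc (t + n)))"
    by (rule F_mono[OF _ m]) simp
  then have "?A \<inter> ?B \<in> sets (F (Suc (t + n)))"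
    using choice_event by (rule sets.Int)
  then show ?case
    unfolding eq using prob_past_choice[OF m, of "Suc n"] p Suc.prems by simp
qed

text \<open>The start times \<open>T + j * n\<close> give disjoint blocks of \<open>n\<close> steps,
  so each attempt is independent of the failures before it.\<close>

lemma prob_no_sweep:
  fixes T n :: nat
  assumes n: "n \<le> N"
  defines "A \<equiv> \<lambda>m. {\<omega> \<in> space M. \<forall>j<m. \<not> sweep n (\<lambda>u. K u \<omega>) (T + j * n)}"
  shows "A m \<in> sets (F (T + m * n)) \<and> prob (A m) = (1 - (1 / N)^n)^m"
proof (induction m)
  case 0
  then show ?case
    using sets.top[of "F T"] space_F by (simp add: A_def prob_space)
next
  case (Suc m)
  let ?t = "T + m * n"
  let ?B = "{\<omega> \<in> space M. sweep n (\<lambda>u. K u \<omega>) ?t}"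
  have m: "A m \<in> sets (F ?t)" and p: "prob (A m) = (1 - (1 / N)^n)^m"
    using Suc by auto
  have eq: "A (Suc m) = A m - (A m \<inter> ?B)"
    by (auto simp: A_def less_Suc_eq)
  note sw = prob_past_sweep[OF m n]
  have "A m \<in> sets (F (?t + n))"
    by (rule F_mono[OF _ m]) simp
  then have "A (Suc m) \<in> sets (F (T + Suc m * n))"
    unfolding eq mult_Suc add.commute[of n] add.assoc[symmetric]
    using sw[THEN conjunct1] by (rule sets.Diff)
  moreover have "prob (A (Suc m)) = prob (A m) - prob (A m \<inter> ?B)"
    unfolding eq by (rule finite_measure_Diff[OF F_events[OF m] F_events[OF sw[THEN conjunct1]]]) blast
  moreover
  have factor: "x - x * y = (1 - y) * x" for x y :: real
    by (simp add: algebra_simps)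
  have "prob (A m) - prob (A m \<inter> ?B) = (1 - (1 / N)^n)^Suc m"
    unfolding sw[THEN conjunct2] p by (simp only: factor power_Suc)
  ultimately show ?case
    by (simp only:)
qed

text \<open>For fixed \<open>T\<close>, failure in all blocks has probability at most
  \<open>?q^m\<close> for every \<open>m\<close>, hence zero; the countably many exceptional sets
  are then combined.\<close>

lemma AE_sweep:
  assumes n: "n \<le> N" and N: "1 \<le> N"
  shows "AE \<omega> in M. \<forall>T. \<exists>t\<ge>T. sweep n (\<lambda>u. K u \<omega>) t"
proof -
  have "AE \<omega> in M. \<exists>t\<ge>T. sweep n (\<lambda>u. K u \<omega>) t" for T
  proof -
    let ?A = "\<lambda>m. {\<omega> \<in> space M. \<forall>j<m. \<not> sweep n (\<lambda>u. K u \<omega>) (T + j * n)}"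
    let ?q = "1 - (1 / real N)^n"
    have ev: "?A m \<in> events" and p: "prob (?A m) = ?q^m" for m
      using prob_no_sweep[OF n, where T = T and m = m] by (blast intro: F_events)+
    have "?q \<ge> 0" "?q < 1"
      using N by (auto simp: power_le_one)
    then have "(\<lambda>m. ?q^m) \<longlonglongrightarrow> 0"
      by (intro LIMSEQ_power_zero) auto
    have le: "prob (\<Inter>m. ?A m) \<le> ?q^m" for m
      unfolding p[symmetric] by (rule finite_measure_mono[OF _ ev]) blast
    have "prob (\<Inter>m. ?A m) \<le> 0"
      by (rule LIMSEQ_le_const[OF \<open>(\<lambda>m. ?q^m) \<longlonglongrightarrow> 0\<close>]) (iprover intro: le)
    then have "prob (\<Inter>m. ?A m) = 0"
      using measure_nonneg[of M "\<Inter>m. ?A m"] by linarith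
    moreover have "(\<Inter>m. ?A m) \<in> events"
      using ev by (intro sets.countable_INT) blast+
    ultimately have avoid: "AE \<omega> in M. \<omega> \<notin> (\<Inter>m. ?A m)"
      by (intro AE_not_in null_setsI) (simp_all only: emeasure_eq_measure ennreal_0)
    have *: "\<exists>t\<ge>T. sweep n (\<lambda>u. K u \<omega>) t"
      if "\<omega> \<notin> (\<Inter>m. ?A m)" and "\<omega> \<in> space M" for \<omega>
      using that le_add1[of T] by blast
    from avoid AE_space show ?thesis
      by eventually_elim (rule *)
  qed
  then show ?thesis
    by (simp add: AE_all_countable)
qed

section \<open>Pathwise convergence of the energy\<close>

text \<open>This separates the increments into winding, compensator and a purely averaged potential.
  The potential starts as the partial sums of
  \<open>incr N (\<theta> 0 \<omega>) j - \<beta>\<close>, the compensator being zero at time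
  0.\<close>

lemma incr_lift:
  fixes \<beta> :: real and \<omega> :: 'w
  defines "s \<equiv> compensator N \<beta> (\<lambda>u. K u \<omega>)"
    and "u \<equiv> averaging N (\<lambda>u. K u \<omega>) (\<lambda>i. \<Sum>j=1..<i. incr N (\<theta> 0 \<omega>) j - \<beta>)"
  assumes N: "2 \<le> N" and \<omega>: "\<omega> \<in> space M" and \<beta>: "\<beta> = 2 * pi * winding N (\<theta> 0 \<omega>) / N"
    and ns: "\<And>t. \<not> singular N (\<theta> t \<omega>)" and i: "i \<in> {1..N}"
  shows "incr N (\<theta> t \<omega>) i = \<beta> + (s t (nxt N i) + u t (nxt N i)) - (s t i + u t i)"
  using i
proof (induction t arbitrary: i)
  case 0
  \<comment> \<open>By its choice, \<open>\<beta>\<close> is the mean of the initial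
    increments.\<close>
  have "(\<Sum>i=1..N. incr N (\<theta> 0 \<omega>) i - \<beta>) = 0"
    using N by (simp add: sum_subtractf \<beta> winding_def)
  then show ?case
    using lift_init[of N "\<lambda>j. incr N (\<theta> 0 \<omega>) j - \<beta>" i] N 0 by (simp add: s_def u_def)
next
  case (Suc t)
  \<comment> \<open>The evolution fixes the configuration on \<open>{1..N}\<close> only, so the
    functions agree there but need not be equal.\<close>
  have "incr N (\<theta> (Suc t) \<omega>) i = incr N (acca_step N (K t \<omega>) (C t \<omega>) (\<theta> t \<omega>)) i"
    using evolution[OF \<omega>] Suc.prems by (rule incr_cong)
  also have "\<dots> = \<beta> + (s (Suc t) (nxt N i) + u (Suc t) (nxt N i)) - (s (Suc t) i + u (Suc t) i)"
    unfolding s_def u_def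
    by (rule lift_step[where \<kappa> = "\<lambda>u. K u \<omega>", OF N _ ns _ Suc.prems])
      (use K_in[OF \<omega>] Suc.IH in \<open>auto simp: s_def u_def\<close>)
  finally show ?case .
qed

text \<open>By the lift each summand is the square of a difference of \<open>u\<close> across an
  edge, and these finitely many differences tend to zero.\<close>

lemma compensated_energy_tendsto_0:
  assumes N: "2 \<le> N" and \<omega>: "\<omega> \<in> space M" and \<beta>: "\<beta> = 2 * pi * winding N (\<theta> 0 \<omega>) / N"
    and ns: "\<And>t. \<not> singular N (\<theta> t \<omega>)" and sw: "\<And>T. \<exists>t\<ge>T. sweep (N - 1) (\<lambda>u. K u \<omega>) t"
  shows "(\<lambda>t. compensated_energy N \<beta> (\<theta> t \<omega>) (compensator N \<beta> (\<lambda>u. K u \<omega>) t)) \<longlonglongrightarrow> 0"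
proof -
  define u where "u = averaging N (\<lambda>u. K u \<omega>) (\<lambda>i. \<Sum>j=1..<i. incr N (\<theta> 0 \<omega>) j - \<beta>)"
  have energy: "compensated_energy N \<beta> (\<theta> t \<omega>) (compensator N \<beta> (\<lambda>u. K u \<omega>) t)
      = (1 / N) * (\<Sum>i=1..N. (u t (nxt N i) - u t i)\<^sup>2)" for t
    unfolding compensated_energy_def u_def
    by (intro arg_cong2[where f = "(*)"] sum.cong refl arg_cong2[where f = power])
       (simp add: incr_lift[OF N \<omega> \<beta> ns])
  have "(\<lambda>t. u t (nxt N i) - u t i) \<longlonglongrightarrow> 0" if "i \<in> {1..N}" for i
    unfolding u_def using N sw K_in[OF \<omega>] that nxt_in[OF that]
    by (intro averaging_diff_tendsto_0) auto
  then have "(\<lambda>t. (1 / N) * (\<Sum>i=1..N. (u t (nxt N i) - u t i)\<^sup>2)) \<longlonglongrightarrow> (1 / N) * (\<Sum>i=1..N. 0\<^sup>2)"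
    by (intro tendsto_intros)
  then show ?thesis
    by (simp add: energy)
qed

end

lemma not_singular_if_first_singular_time_infinity:
  assumes "first_singular_time N \<theta> = \<infinity>"
  shows "\<not> singular N (\<theta> t)"
proof
  assume "singular N (\<theta> t)"
  then have "first_singular_time N \<theta> \<le> enat t"
    unfolding first_singular_time_def by (intro Inf_lower) auto
  then show False
    using assms by simp
qed

theorem theorem4p21:
  fixes M :: "'w measure" and F :: "nat \<Rightarrow> 'w measure" and N :: nat
    and K :: "nat \<Rightarrow> 'w \<Rightarrow> nat" and C :: "nat \<Rightarrow> 'w \<Rightarrow> bool"
    and \<theta> :: "nat \<Rightarrow> 'w \<Rightarrow> nat \<Rightarrow> real"
    and \<beta> :: "'w \<Rightarrow> real"
  assumes "2 \<le> N"
    and "acca M F N K C \<theta>"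
    and "\<And>\<omega>. \<beta> \<omega> = 2 * pi * winding N (\<theta> 0 \<omega>) / real N"
  shows "AE \<omega> in M. first_singular_time N (\<lambda>t. \<theta> t \<omega>) = \<infinity> \<longrightarrow>
           (\<lambda>t. compensated_energy N (\<beta> \<omega>) (\<theta> t \<omega>)
                  (compensator N (\<beta> \<omega>) (\<lambda>u. K u \<omega>) t)) \<longlonglongrightarrow> 0"
proof -
  interpret acca M F N K C \<theta>
    by fact
  \<comment> \<open>Probability enters only here: the edge choices alone determine this event,
    without conditioning on the absence of singularities. The rest is deterministic along each
    trajectory.\<close>
  have "AE \<omega> in M. \<forall>T. \<exists>t\<ge>T. sweep (N - 1) (\<lambda>u. K u \<omega>) t"
    using assms(1) by (intro AE_sweep) auto
  with AE_space show ?thesis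
  proof eventually_elim
    case (elim \<omega>)
    show ?case
    proof
      assume "first_singular_time N (\<lambda>t. \<theta> t \<omega>) = \<infinity>"
      then have "\<not> singular N (\<theta> t \<omega>)" for t
        by (rule not_singular_if_first_singular_time_infinity)
      then show "(\<lambda>t. compensated_energy N (\<beta> \<omega>) (\<theta> t \<omega>)
          (compensator N (\<beta> \<omega>) (\<lambda>u. K u \<omega>) t)) \<longlonglongrightarrow> 0"
        using elim by (intro compensated_energy_tendsto_0[OF assms(1) _ assms(3)]) blast+
    qed
  qed
qed

end
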